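(* Let $BES=\langle\mathcal{B},\mathcal{R}\rangle$ be a Boolean evolution system with transition system $\mathcal{M}$. For each pair of rules $g_1\to X_1$ and $g_2\to X_2$ in $\mathcal{R}$ such that $X_1$ and $X_2$ assign opposite values to the same Boolean variable and $g_1\land g_2\neq false$ (i.e. $g_1\land g_2$ is not identically false), add a new atomic proposition $C$ that holds exactly in the states satisfying $g_1\land g_2$. Let $\mathcal{C}=\{C_1,\dots,C_m\}$ be the set of all propositions so added. Then the first category of inconsistency can be identified by the CTL formula $$\neg EF(C_1\lor\cdots\lor C_m)$$ or the LTL formula $$\neg\Diamond(C_1\lor\cdots\lor C_m),$$ that is, for each of these two formulas, the formula holds in $\mathcal{M}$ (at all initial states) if and only if the first category of inconsistency does not occur in $BES$.
   Context: A Boolean evolution system $BES=\langle\mathcal{B},\mathcal{R}\rangle$ consists of a finite set of variables $\mathcal{B}=\{b_1,\dots,b_n\}$, $n=n_1+n_2$, with $\mathcal{B}^{unknown}=\{b_1,\dots,b_{n_1}\}$ and $\mathcal{B}^{known}=\{b_{n_1+1},\dots,b_{n_1+n_2}\}$, and a finite set $\mathcal{R}$ of rules $g\to X$, where the guard $g$ is a Boolean formula over $\mathcal{B}$ and $X$ assigns $true$ (written $g\to b$) or $false$ (written $g\to\neg b$) to a variable $b\in\mathcal{B}$. A valuation gives each known variable a value in $\{true,false\}$ and each unknown variable a value in $\{true,false,unknown\}$. Guards are evaluated to $true$, $false$ or $unknown$ (strong Kleene three-valued logic); a state satisfies a formula over $\mathcal{B}$ if it evaluates to $true$ there, and a rule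 is enabled at a valuation if its guard evaluates to $true$. It is assumed that at each valuation the set of enabled rules is non-empty. The transition system $\mathcal{M}=\langle S,S_0,T,A,H\rangle$ of $BES$: $S$ is the set of all $3^{n_1}\cdot 2^{n_2}$ valuations; $S_0$ is the set of the $2^{n_2}$ valuations in which all unknown variables have value $unknown$; $(s,s')\in T$ iff $s'$ results from $s$ by simultaneously applying all enabled rules (synchronous semantics): for each variable $b$, $s'(b)=s(b)$ if no enabled rule assigns $b$; $s'(b)=true$ (resp. $false$) if some enabled rule is of the form $g\to b$ (resp. $g\to\neg b$) and no enabled rule assigns the opposite value; and if enabled rules of both forms exist for $b$, then $s'(b)$ may be either $true$ or $false$ (so $k$ conflicting variables give $2^k$ successors). $A$ is the set of atomic propositions and $H(s)$ the set of those valid in $s$. First category of inconsistency: at some time during an evolution from an initial state (i.e. in some state reachable from $S_0$), two enabled rules try to update the same variable with opposite values. CTL has the standard semantics. Satisfaction of LTL at a state is defined in the paper recursively by: $s\models p$ iff $p\in H(s)$; $s\models\neg\varphi$ iff not $s\models\varphi$; $s\models\varphi_1\land\varphi_2$ iff both hold at $s$ (and $\lor$ is the usual abbreviation); $s\models\bigcirc\varphi$ (resp. $\Box\varphi$, $\Diamond\varphi$) iff for all paths $\rho$ starting at $s$, $\rho(1)\models\varphi$ (resp. $\rho(i)\models\varphi$ for all $i\ge 0$; there exists $i\ge0$ with $\rho(i)\models\varphi$). Paths are infinite sequences of states with consecutive states related by $T$. A formula holds in $\mathcal{M}$ if it is satisfied at every state of $S_0$. *)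

theory Defs
  imports Main "HOL-Library.FuncSet"
begin

section \<open>Three-valued Boolean formulas\<close>

datatype tv = TT | FF | UU

fun tv_not :: "tv \<Rightarrow> tv" where
  "tv_not TT = FF"
| "tv_not FF = TT"
| "tv_not UU = UU"

text \<open>Strong Kleene conjunction and disjunction.\<close>

definition tv_and :: "tv \<Rightarrow> tv \<Rightarrow> tv" where
  "tv_and x y = (if x = FF \<or> y = FF then FF else if x = TT \<and> y = TT then TT else UU)"

definition tv_or :: "tv \<Rightarrow> tv \<Rightarrow> tv" where
  "tv_or x y = (if x = TT \<or> y = TT then TT else if x = FF \<and> y = FF then FF else UU)"

datatype (guard_vars: 'v) guard =
    GTrue
  | GFalse
  | GVar 'v
  | GNot "'v guard"
  | GAnd "'v guard" "'v guard"
  | GOr "'v guard" "'v guard"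

primrec eval :: "('v \<Rightarrow> tv) \<Rightarrow> 'v guard \<Rightarrow> tv" where
  "eval s GTrue = TT"
| "eval s GFalse = FF"
| "eval s (GVar b) = s b"
| "eval s (GNot g) = tv_not (eval s g)"
| "eval s (GAnd g h) = tv_and (eval s g) (eval s h)"
| "eval s (GOr g h) = tv_or (eval s g) (eval s h)"

section \<open>Boolean evolution systems\<close>

text \<open>\<open>Rule g b True\<close> is the rule \<open>g \<rightarrow> b\<close>, and \<open>Rule g b False\<close> is \<open>g \<rightarrow> \<not>b\<close>.\<close>

datatype 'v rule = Rule (guard_of: "'v guard") (target: 'v) (new_value: bool)

record 'v bes =
  unknown_vars :: "'v set"
  known_vars :: "'v set"
  rules :: "'v rule set"

definition bes_vars :: "'v bes \<Rightarrow> 'v set" where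
  "bes_vars bes = unknown_vars bes \<union> known_vars bes"

text \<open>Valuations are extensional (\<open>undefined\<close> off the variables), so that there are exactly
  \<open>3 ^ n\<^sub>1 * 2 ^ n\<^sub>2\<close> of them.\<close>

definition valuations :: "'v bes \<Rightarrow> ('v \<Rightarrow> tv) set" where
  "valuations bes =
     (\<Pi>\<^sub>E b \<in> bes_vars bes. if b \<in> unknown_vars bes then {TT, FF, UU} else {TT, FF})"

definition initial_valuations :: "'v bes \<Rightarrow> ('v \<Rightarrow> tv) set" where
  "initial_valuations bes = {s \<in> valuations bes. \<forall>b \<in> unknown_vars bes. s b = UU}"

definition enabled :: "'v bes \<Rightarrow> ('v \<Rightarrow> tv) \<Rightarrow> 'v rule set" where
  "enabled bes s = {r \<in> rules bes. eval s (guard_of r) = TT}"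

definition boolean_evolution_system :: "'v bes \<Rightarrow> bool" where
  "boolean_evolution_system bes \<longleftrightarrow>
     finite (unknown_vars bes) \<and> finite (known_vars bes) \<and>
     unknown_vars bes \<inter> known_vars bes = {} \<and>
     finite (rules bes) \<and>
     (\<forall>r \<in> rules bes. guard_vars (guard_of r) \<subseteq> bes_vars bes \<and> target r \<in> bes_vars bes) \<and>
     (\<forall>s \<in> valuations bes. enabled bes s \<noteq> {})"

definition assigns :: "'v bes \<Rightarrow> ('v \<Rightarrow> tv) \<Rightarrow> 'v \<Rightarrow> bool \<Rightarrow> bool" where
  "assigns bes s b v \<longleftrightarrow> (\<exists>r \<in> enabled bes s. target r = b \<and> new_value r = v)"

definition bes_trans :: "'v bes \<Rightarrow> (('v \<Rightarrow> tv) \<times> ('v \<Rightarrow> tv)) set" where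
  "bes_trans bes = {(s, s'). s \<in> valuations bes \<and> s' \<in> valuations bes \<and>
     (\<forall>b \<in> bes_vars bes.
        (\<not> assigns bes s b True \<and> \<not> assigns bes s b False \<longrightarrow> s' b = s b) \<and>
        (assigns bes s b True \<and> \<not> assigns bes s b False \<longrightarrow> s' b = TT) \<and>
        (\<not> assigns bes s b True \<and> assigns bes s b False \<longrightarrow> s' b = FF) \<and>
        (assigns bes s b True \<and> assigns bes s b False \<longrightarrow> s' b \<in> {TT, FF}))}"

definition first_category_inconsistency :: "'v bes \<Rightarrow> bool" where
  "first_category_inconsistency bes \<longleftrightarrow>
     (\<exists>s0 \<in> initial_valuations bes. \<exists>s. (s0, s) \<in> (bes_trans bes)\<^sup>* \<and>
        (\<exists>r1 \<in> enabled bes s. \<exists>r2 \<in> enabled bes s.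
           target r1 = target r2 \<and> new_value r1 \<noteq> new_value r2))"

section \<open>Transition systems, CTL and LTL\<close>

record ('s, 'p) transition_system =
  states :: "'s set"
  init :: "'s set"
  transitions :: "('s \<times> 's) set"
  props :: "'p set"
  label :: "'s \<Rightarrow> 'p set"

definition paths_from :: "('s, 'p) transition_system \<Rightarrow> 's \<Rightarrow> (nat \<Rightarrow> 's) set" where
  "paths_from M s = {\<rho>. \<rho> 0 = s \<and> (\<forall>i. (\<rho> i, \<rho> (Suc i)) \<in> transitions M)}"

datatype 'p ctl =
    CTrue
  | CAtom 'p
  | CNot "'p ctl"
  | CAnd "'p ctl" "'p ctl"
  | CEX "'p ctl" | CEF "'p ctl" | CEG "'p ctl" | CEU "'p ctl" "'p ctl"
  | CAX "'p ctl" | CAF "'p ctl" | CAG "'p ctl" | CAU "'p ctl" "'p ctl"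

primrec ctl_sat :: "('s, 'p) transition_system \<Rightarrow> 's \<Rightarrow> 'p ctl \<Rightarrow> bool" where
  "ctl_sat M s CTrue \<longleftrightarrow> True"
| "ctl_sat M s (CAtom p) \<longleftrightarrow> p \<in> label M s"
| "ctl_sat M s (CNot f) \<longleftrightarrow> \<not> ctl_sat M s f"
| "ctl_sat M s (CAnd f g) \<longleftrightarrow> ctl_sat M s f \<and> ctl_sat M s g"
| "ctl_sat M s (CEX f) \<longleftrightarrow> (\<exists>\<rho> \<in> paths_from M s. ctl_sat M (\<rho> 1) f)"
| "ctl_sat M s (CEF f) \<longleftrightarrow> (\<exists>\<rho> \<in> paths_from M s. \<exists>i. ctl_sat M (\<rho> i) f)"
| "ctl_sat M s (CEG f) \<longleftrightarrow> (\<exists>\<rho> \<in> paths_from M s. \<forall>i. ctl_sat M (\<rho> i) f)"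
| "ctl_sat M s (CEU f g) \<longleftrightarrow>
     (\<exists>\<rho> \<in> paths_from M s. \<exists>i. ctl_sat M (\<rho> i) g \<and> (\<forall>j<i. ctl_sat M (\<rho> j) f))"
| "ctl_sat M s (CAX f) \<longleftrightarrow> (\<forall>\<rho> \<in> paths_from M s. ctl_sat M (\<rho> 1) f)"
| "ctl_sat M s (CAF f) \<longleftrightarrow> (\<forall>\<rho> \<in> paths_from M s. \<exists>i. ctl_sat M (\<rho> i) f)"
| "ctl_sat M s (CAG f) \<longleftrightarrow> (\<forall>\<rho> \<in> paths_from M s. \<forall>i. ctl_sat M (\<rho> i) f)"
| "ctl_sat M s (CAU f g) \<longleftrightarrow>
     (\<forall>\<rho> \<in> paths_from M s. \<exists>i. ctl_sat M (\<rho> i) g \<and> (\<forall>j<i. ctl_sat M (\<rho> j) f))"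

definition COr :: "'p ctl \<Rightarrow> 'p ctl \<Rightarrow> 'p ctl" where
  "COr f g = CNot (CAnd (CNot f) (CNot g))"

definition ctl_disj :: "'p ctl list \<Rightarrow> 'p ctl" where
  "ctl_disj fs = foldr COr fs (CNot CTrue)"

definition ctl_holds :: "('s, 'p) transition_system \<Rightarrow> 'p ctl \<Rightarrow> bool" where
  "ctl_holds M f \<longleftrightarrow> (\<forall>s \<in> init M. ctl_sat M s f)"

datatype 'p ltl =
    LTrue
  | LAtom 'p
  | LNot "'p ltl"
  | LAnd "'p ltl" "'p ltl"
  | LNext "'p ltl"
  | LAlways "'p ltl"
  | LEventually "'p ltl"

text \<open>Satisfaction is defined at states, each temporal operator quantifying over all paths from
  the state, and negation is negation of satisfaction at the state. In particular
  \<open>LNot (LEventually f)\<close> says that some path avoids \<open>f\<close>, unlike in the usual path semantics,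
  where it says that every path does.\<close>

primrec ltl_sat :: "('s, 'p) transition_system \<Rightarrow> 's \<Rightarrow> 'p ltl \<Rightarrow> bool" where
  "ltl_sat M s LTrue \<longleftrightarrow> True"
| "ltl_sat M s (LAtom p) \<longleftrightarrow> p \<in> label M s"
| "ltl_sat M s (LNot f) \<longleftrightarrow> \<not> ltl_sat M s f"
| "ltl_sat M s (LAnd f g) \<longleftrightarrow> ltl_sat M s f \<and> ltl_sat M s g"
| "ltl_sat M s (LNext f) \<longleftrightarrow> (\<forall>\<rho> \<in> paths_from M s. ltl_sat M (\<rho> 1) f)"
| "ltl_sat M s (LAlways f) \<longleftrightarrow> (\<forall>\<rho> \<in> paths_from M s. \<forall>i. ltl_sat M (\<rho> i) f)"
| "ltl_sat M s (LEventually f) \<longleftrightarrow> (\<forall>\<rho> \<in> paths_from M s. \<exists>i. ltl_sat M (\<rho> i) f)"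

definition LOr :: "'p ltl \<Rightarrow> 'p ltl \<Rightarrow> 'p ltl" where
  "LOr f g = LNot (LAnd (LNot f) (LNot g))"

definition ltl_disj :: "'p ltl list \<Rightarrow> 'p ltl" where
  "ltl_disj fs = foldr LOr fs (LNot LTrue)"

definition ltl_holds :: "('s, 'p) transition_system \<Rightarrow> 'p ltl \<Rightarrow> bool" where
  "ltl_holds M f \<longleftrightarrow> (\<forall>s \<in> init M. ltl_sat M s f)"

section \<open>The transition system of a Boolean evolution system\<close>

definition bes_ts ::
    "'v bes \<Rightarrow> 'p set \<Rightarrow> (('v \<Rightarrow> tv) \<Rightarrow> 'p set) \<Rightarrow> ('v \<Rightarrow> tv, 'p) transition_system" where
  "bes_ts bes A H =
     \<lparr>states = valuations bes, init = initial_valuations bes, transitions = bes_trans bes,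
      props = A, label = H\<rparr>"

definition identically_false :: "'v bes \<Rightarrow> 'v guard \<Rightarrow> bool" where
  "identically_false bes g \<longleftrightarrow> (\<forall>s \<in> valuations bes. eval s g = FF)"

text \<open>An unordered pair of rules with opposite assignments is represented once, with the rule
  assigning true as first component.\<close>

definition conflict_pairs :: "'v bes \<Rightarrow> ('v rule \<times> 'v rule) set" where
  "conflict_pairs bes = {(r1, r2). r1 \<in> rules bes \<and> r2 \<in> rules bes \<and>
     target r1 = target r2 \<and> new_value r1 \<and> \<not> new_value r2 \<and>
     \<not> identically_false bes (GAnd (guard_of r1) (guard_of r2))}"

text \<open>The constructors make the added propositions distinct from the original ones and from
  each other.\<close>

datatype ('p, 'v) ext_prop = Orig 'p | Conflict "'v rule" "'v rule"

definition conflict_props :: "'v bes \<Rightarrow> ('p, 'v) ext_prop set" where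
  "conflict_props bes = {Conflict r1 r2 | r1 r2. (r1, r2) \<in> conflict_pairs bes}"

definition add_conflict_props ::
    "'v bes \<Rightarrow> ('v \<Rightarrow> tv, 'p) transition_system \<Rightarrow>
     ('v \<Rightarrow> tv, ('p, 'v) ext_prop) transition_system" where
  "add_conflict_props bes M =
     \<lparr>states = states M, init = init M, transitions = transitions M,
      props = Orig ` props M \<union> conflict_props bes,
      label = (\<lambda>s. Orig ` label M s \<union>
        {Conflict r1 r2 | r1 r2. (r1, r2) \<in> conflict_pairs bes \<and>
           eval s (GAnd (guard_of r1) (guard_of r2)) = TT})\<rparr>"

end

theory Submission
  imports Defs
begin

text \<open>A state without conflicting enabled rules has exactly one successor. So all paths from a
  state agree up to the first conflict, and a conflict reached on one path is met on every path.
  As every state has a successor, paths exist; hence \<open>EF\<close> and the state-based \<open>\<diamond>\<close> of LTL, which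
  quantifies over all paths, agree on the disjunction of the conflict propositions.\<close>

definition rule_conflict :: "'v bes \<Rightarrow> ('v \<Rightarrow> tv) \<Rightarrow> bool" where
  "rule_conflict bes s \<longleftrightarrow> (\<exists>r1 \<in> enabled bes s. \<exists>r2 \<in> enabled bes s.
     target r1 = target r2 \<and> new_value r1 \<noteq> new_value r2)"

lemma ctl_sat_disj: "ctl_sat M s (ctl_disj fs) \<longleftrightarrow> (\<exists>f \<in> set fs. ctl_sat M s f)"
  by (induction fs) (auto simp: ctl_disj_def COr_def)

lemma ltl_sat_disj: "ltl_sat M s (ltl_disj fs) \<longleftrightarrow> (\<exists>f \<in> set fs. ltl_sat M s f)"
  by (induction fs) (auto simp: ltl_disj_def LOr_def)

lemma eval_GAnd_TT: "eval s (GAnd g h) = TT \<longleftrightarrow> eval s g = TT \<and> eval s h = TT"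
  by (auto simp: tv_and_def)

text \<open>The filter \<open>\<not> identically_false\<close> in \<open>conflict_pairs\<close>
  loses no actual conflict: if two opposing rules are enabled at \<open>s\<close>, then
  \<open>s\<close> itself is a valuation where the conjunction of their guards is true.\<close>

lemma conflict_label_iff:
  assumes "s \<in> valuations bes"
  shows "(\<exists>c \<in> conflict_props bes. c \<in> label (add_conflict_props bes M) s) \<longleftrightarrow>
         rule_conflict bes s"
proof
  assume "\<exists>c \<in> conflict_props bes. c \<in> label (add_conflict_props bes M) s"
  then obtain r1 r2 where "(r1, r2) \<in> conflict_pairs bes"
      and "eval s (GAnd (guard_of r1) (guard_of r2)) = TT"
    by (auto simp: conflict_props_def add_conflict_props_def)
  then show "rule_conflict bes s"
    unfolding rule_conflict_def conflict_pairs_def enabled_def eval_GAnd_TT by blast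
next
  assume "rule_conflict bes s"
  \<comment> \<open>\<open>rule_conflict\<close> is symmetric in the two rules, so they can be
    ordered as \<open>conflict_pairs\<close> demands, the one assigning true first.\<close>
  then obtain r1 r2 where r: "r1 \<in> enabled bes s" "r2 \<in> enabled bes s"
      "target r1 = target r2" "new_value r1" "\<not> new_value r2"
    unfolding rule_conflict_def by metis
  then have sat: "eval s (GAnd (guard_of r1) (guard_of r2)) = TT"
    unfolding enabled_def eval_GAnd_TT by blast
  then have "\<not> identically_false bes (GAnd (guard_of r1) (guard_of r2))"
    unfolding identically_false_def using assms by force
  with r have "(r1, r2) \<in> conflict_pairs bes"
    by (simp add: conflict_pairs_def enabled_def)
  with sat show "\<exists>c \<in> conflict_props bes. c \<in> label (add_conflict_props bes M) s"
    by (intro bexI[of _ "Conflict r1 r2"])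
       (auto simp: conflict_props_def add_conflict_props_def simp del: eval.simps)
qed

lemma rule_conflict_iff_assigns:
  "rule_conflict bes s \<longleftrightarrow> (\<exists>b. assigns bes s b True \<and> assigns bes s b False)"
  unfolding rule_conflict_def assigns_def by metis

text \<open>Only the last clause of \<open>bes_trans\<close> leaves a choice, and it applies only to
  a variable assigned both values. Valuations are extensional, so agreement on
  \<open>bes_vars bes\<close> is equality.\<close>

lemma bes_trans_functional:
  assumes "\<not> rule_conflict bes s" "(s, t) \<in> bes_trans bes" "(s, u) \<in> bes_trans bes"
  shows "t = u"
proof (rule PiE_ext)
  show "t \<in> (\<Pi>\<^sub>E b \<in> bes_vars bes. if b \<in> unknown_vars bes then {TT, FF, UU} else {TT, FF})"
       "u \<in> (\<Pi>\<^sub>E b \<in> bes_vars bes. if b \<in> unknown_vars bes then {TT, FF, UU} else {TT, FF})"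
    using assms(2,3) by (simp_all add: bes_trans_def valuations_def)
next
  fix b assume "b \<in> bes_vars bes"
  then show "t b = u b"
    using assms unfolding bes_trans_def rule_conflict_iff_assigns by simp metis
qed

lemma bes_trans_total:
  assumes "s \<in> valuations bes"
  shows "\<exists>t. (s, t) \<in> bes_trans bes"
proof -
  \<comment> \<open>This successor resolves every conflict in favour of true;
    \<open>undefined\<close> off the variables keeps it extensional.\<close>
  define t where "t = (\<lambda>b. if b \<in> bes_vars bes
      then (if assigns bes s b True then TT else if assigns bes s b False then FF else s b)
      else undefined)"
  have "t \<in> valuations bes"
    using assms unfolding valuations_def t_def by (auto simp: PiE_iff extensional_def)
  then have "(s, t) \<in> bes_trans bes"
    using assms unfolding bes_trans_def by (simp add: t_def)
  then show ?thesis by blast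
qed

lemma bes_trans_valuations: "(s, t) \<in> bes_trans bes \<Longrightarrow> t \<in> valuations bes"
  by (simp add: bes_trans_def)

lemma paths_from_nonempty:
  assumes "s \<in> valuations bes" "transitions M = bes_trans bes"
  shows "paths_from M s \<noteq> {}"
proof -
  \<comment> \<open>The choice predicate carries membership in \<open>valuations bes\<close>, which
    totality needs for the next step, and fixes the start through its case
    \<open>i = 0\<close>.\<close>
  have "\<exists>\<rho>. \<forall>i. (\<rho> i \<in> valuations bes \<and> (i = 0 \<longrightarrow> \<rho> i = s)) \<and> (\<rho> i, \<rho> (Suc i)) \<in> bes_trans bes"
    by (rule dependent_nat_choice) (use assms bes_trans_total bes_trans_valuations in blast)+
  then show ?thesis
    using assms(2) by (auto simp: paths_from_def)
qed

lemma paths_from_reachable: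
  assumes "\<rho> \<in> paths_from M s"
  shows "(s, \<rho> i) \<in> (transitions M)\<^sup>*"
  using assms by (induction i) (auto simp: paths_from_def intro: rtrancl_into_rtrancl)

text \<open>Induction peels off the first transition: either \<open>s\<close> already has a
  conflict, met at index 0, or its successor is unique and \<open>\<rho>\<close> is forced through
  it. The path is generalized because the induction hypothesis is applied to its tail.\<close>

lemma reachable_conflict_unavoidable:
  assumes "(s, t) \<in> (bes_trans bes)\<^sup>*" "rule_conflict bes t"
    and "transitions M = bes_trans bes" "\<rho> \<in> paths_from M s"
  shows "\<exists>i. rule_conflict bes (\<rho> i)"
  using assms(1,4)
proof (induction arbitrary: \<rho> rule: converse_rtrancl_induct)
  case base
  with assms(2) show ?case by (auto simp: paths_from_def)
next
  case (step s s')
  show ?case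
  proof (cases "rule_conflict bes s")
    case True
    with step.prems show ?thesis by (auto simp: paths_from_def)
  next
    case False
    have "(s, \<rho> 1) \<in> bes_trans bes"
      using step.prems assms(3) by (auto simp: paths_from_def)
    with False step.hyps(1) have "\<rho> 1 = s'"
      using bes_trans_functional by blast
    with step.prems have "(\<lambda>i. \<rho> (Suc i)) \<in> paths_from M s'"
      by (simp add: paths_from_def)
    with step.IH show ?thesis by blast
  qed
qed

theorem theorem2:
  fixes bes :: "'v bes"
    and A :: "'p set"
    and H :: "('v \<Rightarrow> tv) \<Rightarrow> 'p set"
    and Cs :: "('p, 'v) ext_prop list"
  assumes "boolean_evolution_system bes"
    and "\<And>s. s \<in> valuations bes \<Longrightarrow> H s \<subseteq> A"
    and "distinct Cs" and "set Cs = conflict_props bes"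
  shows "(ctl_holds (add_conflict_props bes (bes_ts bes A H))
            (CNot (CEF (ctl_disj (map CAtom Cs))))
          \<longleftrightarrow> \<not> first_category_inconsistency bes) \<and>
         (ltl_holds (add_conflict_props bes (bes_ts bes A H))
            (LNot (LEventually (ltl_disj (map LAtom Cs))))
          \<longleftrightarrow> \<not> first_category_inconsistency bes)"
proof -
  define M where "M = add_conflict_props bes (bes_ts bes A H)"
  have M: "transitions M = bes_trans bes" "init M = initial_valuations bes"
    by (simp_all add: M_def add_conflict_props_def bes_ts_def)
  have init_val: "s \<in> valuations bes" if "s \<in> init M" for s
    using that M(2) by (simp add: initial_valuations_def)
  have path_val: "\<rho> i \<in> valuations bes" if "s \<in> init M" "\<rho> \<in> paths_from M s" for s \<rho> i
    using that init_val[OF that(1)] M(1)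
    by (cases i) (auto simp: paths_from_def intro: bes_trans_valuations)
  \<comment> \<open>The disjunctions contain no temporal operator, so both depend only on the labels
    at \<open>\<rho> i\<close>.\<close>
  have ctl: "ctl_sat M (\<rho> i) (ctl_disj (map CAtom Cs)) \<longleftrightarrow> rule_conflict bes (\<rho> i)"
    and ltl: "ltl_sat M (\<rho> i) (ltl_disj (map LAtom Cs)) \<longleftrightarrow> rule_conflict bes (\<rho> i)"
    if "s \<in> init M" "\<rho> \<in> paths_from M s" for s \<rho> i
    using conflict_label_iff[OF path_val[OF that]] assms(4)
    by (simp_all add: ctl_sat_disj ltl_sat_disj M_def)
  have inconsistency: "first_category_inconsistency bes \<longleftrightarrow>
      (\<exists>s0 \<in> init M. \<exists>s. (s0, s) \<in> (bes_trans bes)\<^sup>* \<and> rule_conflict bes s)"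
    by (simp add: first_category_inconsistency_def rule_conflict_def M(2))
  have some_path: "first_category_inconsistency bes"
    if "s \<in> init M" "\<rho> \<in> paths_from M s" "rule_conflict bes (\<rho> i)" for s \<rho> i
    using that paths_from_reachable[OF that(2)] inconsistency M(1) by metis
  have all_paths: "\<exists>s \<in> init M. \<forall>\<rho> \<in> paths_from M s. \<exists>i. rule_conflict bes (\<rho> i)"
    if "first_category_inconsistency bes"
    using that inconsistency reachable_conflict_unavoidable M(1) by metis
  have nonempty: "paths_from M s \<noteq> {}" if "s \<in> init M" for s
    using paths_from_nonempty[OF init_val[OF that] M(1)] .
  have "ctl_holds M (CNot (CEF (ctl_disj (map CAtom Cs)))) \<longleftrightarrow>
      \<not> (\<exists>s \<in> init M. \<exists>\<rho> \<in> paths_from M s. \<exists>i. rule_conflict bes (\<rho> i))"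
    using ctl by (auto simp: ctl_holds_def)
  \<comment> \<open>Negation acts at the state, so the formula fails exactly when all paths from
    some initial state meet a conflict.\<close>
  moreover have "ltl_holds M (LNot (LEventually (ltl_disj (map LAtom Cs)))) \<longleftrightarrow>
      \<not> (\<exists>s \<in> init M. \<forall>\<rho> \<in> paths_from M s. \<exists>i. rule_conflict bes (\<rho> i))"
    using ltl by (auto simp: ltl_holds_def)
  \<comment> \<open>The implications close a cycle: conflict on some path, inconsistency, conflict
    on all paths from some initial state, and back by \<open>nonempty\<close>.\<close>
  ultimately show ?thesis
    unfolding M_def[symmetric] using some_path all_paths nonempty by blast
qed

end
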